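(* Let $p$ be a prime and let $A$ be a $\delta$-Cartier ring. Then $V:A\to A$ is injective.
   Context: All rings are commutative with unit. A $\delta$-ring is a ring $A$ with a map $\delta:A\to A$ such that $\delta(0)=\delta(1)=0$, $\delta(x+y)=\delta(x)+\delta(y)-\sum_{i=1}^{p-1}\frac1p\binom pi x^iy^{p-i}$ and $\delta(xy)=x^p\delta(y)+y^p\delta(x)+p\delta(x)\delta(y)$; its Frobenius is $F(a)=a^p+p\delta(a)$. A $\delta$-Cartier ring is a $\delta$-ring $A$ with an additive map $V:A\to A$ such that for all $a,b\in A$: (1) $F(V(a))=pa$; (2) $aV(b)=V(F(a)b)$; (3) $\delta(V(a))=a-p^{p-2}V(a^p)$. *)

theory Defs
  imports "HOL-Algebra.Ring" "HOL-Computational_Algebra.Primes"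
begin

(* Rings are carrier-based (cring), so that the zero ring is included;
   the type class comm_ring_1 would exclude it. The integer multiple n x is [n] \<cdot> x.
   The parameter p is meant to be prime: then p divides p choose i for 0 < i < p,
   so the natural-number quotient (p choose i) div p is exact. *)

locale delta_ring = cring A for A :: "('a, 'b) ring_scheme" (structure) +
  fixes p :: nat and \<delta> :: "'a \<Rightarrow> 'a"
  assumes delta_closed: "\<delta> \<in> carrier A \<rightarrow> carrier A"
    and delta_zero: "\<delta> \<zero> = \<zero>"
    and delta_one: "\<delta> \<one> = \<zero>"
    and delta_add: "\<lbrakk>x \<in> carrier A; y \<in> carrier A\<rbrakk> \<Longrightarrow>
      \<delta> (x \<oplus> y) = (\<delta> x \<oplus> \<delta> y) \<ominus>
        (\<Oplus>i\<in>{1..p-1}. [((p choose i) div p)] \<cdot> (x [^] i \<otimes> y [^] (p - i)))"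
    and delta_mult: "\<lbrakk>x \<in> carrier A; y \<in> carrier A\<rbrakk> \<Longrightarrow>
      \<delta> (x \<otimes> y) =
        x [^] p \<otimes> \<delta> y \<oplus> y [^] p \<otimes> \<delta> x \<oplus> [p] \<cdot> (\<delta> x \<otimes> \<delta> y)"
begin

definition Frob :: "'a \<Rightarrow> 'a" where
  "Frob a = a [^] p \<oplus> [p] \<cdot> \<delta> a"

end

locale delta_Cartier_ring = delta_ring A p \<delta>
  for A :: "('a, 'b) ring_scheme" (structure) and p :: nat and \<delta> :: "'a \<Rightarrow> 'a" +
  fixes V :: "'a \<Rightarrow> 'a"
  assumes V_closed: "V \<in> carrier A \<rightarrow> carrier A"
    and V_add: "\<lbrakk>a \<in> carrier A; b \<in> carrier A\<rbrakk> \<Longrightarrow> V (a \<oplus> b) = V a \<oplus> V b"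
    and Frob_V: "a \<in> carrier A \<Longrightarrow> Frob (V a) = [p] \<cdot> a"
    and mult_V: "\<lbrakk>a \<in> carrier A; b \<in> carrier A\<rbrakk> \<Longrightarrow> a \<otimes> V b = V (Frob a \<otimes> b)"
    and delta_V: "a \<in> carrier A \<Longrightarrow>
      \<delta> (V a) = a \<ominus> [(p ^ (p - 2))] \<cdot> V (a [^] p)"

end

theory Submission
  imports Defs "HOL-Algebra.Multiplicative_Group"
begin

text \<open>
  As \<open>V\<close> is additive, it suffices to show that its kernel vanishes. Let \<open>V a = 0\<close>. Applying
  \<open>F\<close> gives \<open>p a = 0\<close>, and applying \<open>\<delta>\<close> gives \<open>a = p\<^sup>p\<^sup>-\<^sup>2 V(a\<^sup>p)\<close>. Hence \<open>a = V c\<close> with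
  \<open>c = p\<^sup>p\<^sup>-\<^sup>2 a\<^sup>p\<close>, so \<open>a\<close> lies in the image of \<open>V\<close> as well. This forces \<open>F a = p c = 0\<close>, because
  \<open>c\<close> is a multiple of \<open>a\<close>, and then the projection formula gives \<open>a\<^sup>2 = a V(c) = V(F(a) c) = 0\<close>.
  Since \<open>p \<ge> 2\<close>, also \<open>a\<^sup>p = 0\<close>, and the equation for \<open>a\<close> collapses to \<open>a = 0\<close>.
\<close>

context delta_Cartier_ring
begin

lemma V_zero: "V \<zero> = \<zero>"
proof -
  have cl: "V \<zero> \<in> carrier A" using V_closed by auto
  have "V \<zero> \<oplus> V \<zero> = V \<zero>" using V_add[of \<zero> \<zero>] by simp
  then show ?thesis using cl by (metis add.r_cancel_one' zero_closed)
qed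

lemma V_add_pow:
  assumes "a \<in> carrier A"
  shows "V ([(n::nat)] \<cdot> a) = [n] \<cdot> V a"
proof (induction n)
  case 0
  then show ?case by (simp add: V_zero)
next
  case (Suc n)
  then show ?case using assms by (simp add: V_add)
qed

text \<open>
  The projection formula with \<open>a = V c\<close> turns the square \<open>a V(c)\<close> into \<open>V(F(a) c)\<close>.
\<close>
lemma square_zero_if_Frob_zero:
  assumes "c \<in> carrier A" and "Frob (V c) = \<zero>"
  shows "V c \<otimes> V c = \<zero>"
  using assms mult_V[of "V c" c] V_closed by (auto simp: V_zero)

lemma V_kernel_trivial:
  assumes p: "2 \<le> p" and a: "a \<in> carrier A" and Va: "V a = \<zero>"
  shows "a = \<zero>"
proof -
  define c where "c = [(p ^ (p - 2))] \<cdot> (a [^] p)"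
  have c: "c \<in> carrier A" using a by (simp add: c_def)
  have pow: "a [^] p = (a \<otimes> a) \<otimes> a [^] (p - 2)"
  proof -
    have "a [^] (2::nat) \<otimes> a [^] (p - 2) = a [^] p"
      using p a by (simp only: nat_pow_mult le_add_diff_inverse)
    then show ?thesis using a by (simp add: numeral_2_eq_2)
  qed
  have "[p] \<cdot> a = Frob \<zero>" using Frob_V[OF a] Va by simp
  also have "\<dots> = \<zero>" using p by (simp add: Frob_def delta_zero nat_pow_zero)
  finally have pa: "[p] \<cdot> a = \<zero>" .
  have "a \<ominus> V c = \<zero>"
    using delta_V[OF a] Va a by (simp add: delta_zero c_def V_add_pow)
  then have a_eq: "a = V c" using a c V_closed by (metis Pi_mem r_right_minus_eq)
  have "[p] \<cdot> (a [^] p) = ([p] \<cdot> a) \<otimes> (a \<otimes> a [^] (p - 2))"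
    using a by (simp add: pow add_pow_ldistr m_assoc)
  then have "[p] \<cdot> (a [^] p) = \<zero>" using a pa by simp
  then have "[p] \<cdot> c = \<zero>"
    using a unfolding c_def by (metis add.nat_pow_pow add.nat_pow_one mult.commute nat_pow_closed)
  then have "Frob (V c) = \<zero>" using Frob_V[OF c] by simp
  then have "a \<otimes> a = \<zero>" using square_zero_if_Frob_zero[OF c] a_eq by simp
  then have "c = \<zero>" using a by (simp add: c_def pow)
  then show ?thesis using a_eq V_zero by simp
qed

end

theorem proposition5p19:
  fixes A :: "('a, 'b) ring_scheme" and p :: nat and \<delta> V :: "'a \<Rightarrow> 'a"
  assumes "prime p"
    and "delta_Cartier_ring A p \<delta> V"
  shows "inj_on V (carrier A)"
proof -
  interpret delta_Cartier_ring A p \<delta> V by (rule assms(2))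
  show ?thesis
  proof (rule inj_onI)
    fix a b assume a: "a \<in> carrier A" and b: "b \<in> carrier A" and eq: "V a = V b"
    have d: "a \<ominus>\<^bsub>A\<^esub> b \<in> carrier A" using a b by simp
    have "(a \<ominus>\<^bsub>A\<^esub> b) \<oplus>\<^bsub>A\<^esub> b = a" using a b by (simp add: minus_eq a_assoc l_neg)
    then have "V (a \<ominus>\<^bsub>A\<^esub> b) \<oplus>\<^bsub>A\<^esub> V b = V b" using V_add[OF d b] eq by simp
    then have "V (a \<ominus>\<^bsub>A\<^esub> b) = \<zero>\<^bsub>A\<^esub>"
      using b d V_closed by (metis Pi_mem add.r_cancel_one)
    then have "a \<ominus>\<^bsub>A\<^esub> b = \<zero>\<^bsub>A\<^esub>"
      using V_kernel_trivial d prime_ge_2_nat[OF assms(1)] by blast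
    then show "a = b" using a b by (metis r_right_minus_eq)
  qed
qed

end
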